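(* Let $Q$ be a quandle generated by a set $X\subseteq Q$ such that the natural map $\eta:Q\to\operatorname{Conj}(\operatorname{Env}(Q))$ is injective. If there exist two distinct commuting elements in $\operatorname{Env}(Q)$ that are not inverses of each other and each of which is a conjugate (in $\operatorname{Env}(Q)$) of an element of $\eta(X)^{\pm1}=\eta(X)\cup\{g^{-1}\mid g\in\eta(X)\}$, then the quandle $Q$ is not left-orderable.
   Context: A quandle is a non-empty set $Q$ with a binary operation $*$ such that $x*x=x$; for all $x,y$ there is a unique $z$ (denoted $x*^{-1}y$) with $x=z*y$; and $(x*y)*z=(x*z)*(y*z)$. $Q$ is generated by $X$ if every element of $Q$ can be obtained from elements of $X$ using $*$ and $*^{-1}$. $Q$ is left-orderable if it has a (strict) linear order $<$ such that $x<y$ implies $z*x<z*y$ for all $x,y,z\in Q$. The enveloping group $\operatorname{Env}(Q)$ is the group generated by $\{\tilde x\mid x\in Q\}$ with defining relations $\widetilde{x*y}=\tilde y^{-1}\tilde x\tilde y$ for all $x,y\in Q$. For a group $G$, $\operatorname{Conj}(G)$ is the quandle on $G$ with $x*y=y^{-1}xy$. The natural map $\eta$ is the quandle homomorphism $\eta(x)=\tilde x$. *)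

theory Defs
  imports "HOL-Algebra.Group"
begin

locale quandle =
  fixes Q :: "'a set" and star :: "'a \<Rightarrow> 'a \<Rightarrow> 'a" (infixl \<open>\<star>\<close> 70)
  assumes nonempty: "Q \<noteq> {}"
    and closed: "\<lbrakk>x \<in> Q; y \<in> Q\<rbrakk> \<Longrightarrow> x \<star> y \<in> Q"
    and idem: "x \<in> Q \<Longrightarrow> x \<star> x = x"
    and right_div: "\<lbrakk>x \<in> Q; y \<in> Q\<rbrakk> \<Longrightarrow> \<exists>!z. z \<in> Q \<and> x = z \<star> y"
    and distrib: "\<lbrakk>x \<in> Q; y \<in> Q; z \<in> Q\<rbrakk> \<Longrightarrow> (x \<star> y) \<star> z = (x \<star> z) \<star> (y \<star> z)"

definition quandle_inv_op :: "'a set \<Rightarrow> ('a \<Rightarrow> 'a \<Rightarrow> 'a) \<Rightarrow> 'a \<Rightarrow> 'a \<Rightarrow> 'a" where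
  "quandle_inv_op Q star x y = (THE z. z \<in> Q \<and> x = star z y)"

inductive_set quandle_span :: "'a set \<Rightarrow> ('a \<Rightarrow> 'a \<Rightarrow> 'a) \<Rightarrow> 'a set \<Rightarrow> 'a set"
  for Q :: "'a set" and star :: "'a \<Rightarrow> 'a \<Rightarrow> 'a" and X :: "'a set" where
  gen: "x \<in> X \<Longrightarrow> x \<in> quandle_span Q star X"
| star: "\<lbrakk>x \<in> quandle_span Q star X; y \<in> quandle_span Q star X\<rbrakk>
    \<Longrightarrow> star x y \<in> quandle_span Q star X"
| inv_star: "\<lbrakk>x \<in> quandle_span Q star X; y \<in> quandle_span Q star X\<rbrakk>
    \<Longrightarrow> quandle_inv_op Q star x y \<in> quandle_span Q star X"

definition quandle_generated_by :: "'a set \<Rightarrow> ('a \<Rightarrow> 'a \<Rightarrow> 'a) \<Rightarrow> 'a set \<Rightarrow> bool" where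
  "quandle_generated_by Q star X \<longleftrightarrow> X \<subseteq> Q \<and> quandle_span Q star X = Q"

definition left_orderable :: "'a set \<Rightarrow> ('a \<Rightarrow> 'a \<Rightarrow> 'a) \<Rightarrow> bool" where
  "left_orderable Q star \<longleftrightarrow>
    (\<exists>r. r \<subseteq> Q \<times> Q \<and> strict_linear_order_on Q r \<and>
      (\<forall>x\<in>Q. \<forall>y\<in>Q. \<forall>z\<in>Q. (x, y) \<in> r \<longrightarrow> (star z x, star z y) \<in> r))"

definition quandle_hom ::
  "'a set \<Rightarrow> ('a \<Rightarrow> 'a \<Rightarrow> 'a) \<Rightarrow> 'b set \<Rightarrow> ('b \<Rightarrow> 'b \<Rightarrow> 'b) \<Rightarrow> ('a \<Rightarrow> 'b) set" where
  "quandle_hom Q star P op =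
    {f. f \<in> Q \<rightarrow> P \<and> (\<forall>x\<in>Q. \<forall>y\<in>Q. f (star x y) = op (f x) (f y))}"

text \<open>The quandle \<open>Conj(G)\<close> has underlying set \<^term>\<open>carrier G\<close> and this operation.\<close>

definition conj_op :: "('a, 'm) monoid_scheme \<Rightarrow> 'a \<Rightarrow> 'a \<Rightarrow> 'a" where
  "conj_op G x y = inv\<^bsub>G\<^esub> y \<otimes>\<^bsub>G\<^esub> x \<otimes>\<^bsub>G\<^esub> y"

definition conjugate_in :: "('a, 'm) monoid_scheme \<Rightarrow> 'a \<Rightarrow> 'a \<Rightarrow> bool" where
  "conjugate_in G a h \<longleftrightarrow> (\<exists>g\<in>carrier G. a = inv\<^bsub>G\<^esub> g \<otimes>\<^bsub>G\<^esub> h \<otimes>\<^bsub>G\<^esub> g)"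

text \<open>The letter \<open>(x, True)\<close> stands for the generator \<open>x\<close> and \<open>(x, False)\<close> for its formal
  inverse. The group with generating set \<open>S\<close> and defining relations \<open>u = v\<close> for \<open>(u, v) \<in> R\<close>
  is the set of words over \<open>S\<close> modulo the least congruence containing \<open>R\<close> and the free
  cancellations.\<close>

type_synonym 'a word = "('a \<times> bool) list"

definition words :: "'a set \<Rightarrow> 'a word set" where
  "words S = lists (S \<times> UNIV)"

inductive pres_eq :: "'a set \<Rightarrow> ('a word \<times> 'a word) set \<Rightarrow> 'a word \<Rightarrow> 'a word \<Rightarrow> bool"
  for S :: "'a set" and R :: "('a word \<times> 'a word) set" where
  refl: "w \<in> words S \<Longrightarrow> pres_eq S R w w"
| sym: "pres_eq S R u v \<Longrightarrow> pres_eq S R v u"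
| trans: "\<lbrakk>pres_eq S R u v; pres_eq S R v w\<rbrakk> \<Longrightarrow> pres_eq S R u w"
| append: "\<lbrakk>pres_eq S R u u'; pres_eq S R v v'\<rbrakk> \<Longrightarrow> pres_eq S R (u @ v) (u' @ v')"
| cancel: "x \<in> S \<Longrightarrow> pres_eq S R [(x, b), (x, \<not> b)] []"
| rel: "\<lbrakk>(u, v) \<in> R; u \<in> words S; v \<in> words S\<rbrakk> \<Longrightarrow> pres_eq S R u v"

definition pres_rel :: "'a set \<Rightarrow> ('a word \<times> 'a word) set \<Rightarrow> ('a word \<times> 'a word) set" where
  "pres_rel S R = {(u, v). pres_eq S R u v}"

definition presented_group :: "'a set \<Rightarrow> ('a word \<times> 'a word) set \<Rightarrow> 'a word set monoid" where
  "presented_group S R =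
    \<lparr>carrier = words S // pres_rel S R,
     mult = (\<lambda>A B. \<Union>u\<in>A. \<Union>v\<in>B. pres_rel S R `` {u @ v}),
     one = pres_rel S R `` {[]}\<rparr>"

lemma pres_eq_words: "pres_eq S R u v \<Longrightarrow> u \<in> words S \<and> v \<in> words S"
  by (induction rule: pres_eq.induct) (auto simp: words_def)

lemma equiv_pres_rel: "equiv (words S) (pres_rel S R)"
  by (rule equivI)
    (auto simp: pres_rel_def refl_on_def sym_def trans_def
      dest: pres_eq_words intro: pres_eq.refl pres_eq.sym pres_eq.trans)

lemma pres_class_eq_iff:
  assumes "u \<in> words S" "v \<in> words S"
  shows "pres_rel S R `` {u} = pres_rel S R `` {v} \<longleftrightarrow> pres_eq S R u v"
  using eq_equiv_class_iff[OF equiv_pres_rel assms] by (simp add: pres_rel_def)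

lemma presented_group_one: "\<one>\<^bsub>presented_group S R\<^esub> = pres_rel S R `` {[]}"
  by (simp add: presented_group_def)

lemma presented_group_carrier: "carrier (presented_group S R) = (\<lambda>u. pres_rel S R `` {u}) ` words S"
  by (auto simp: presented_group_def quotient_def)

lemma presented_group_mult:
  assumes "u \<in> words S" "v \<in> words S"
  shows "(pres_rel S R `` {u}) \<otimes>\<^bsub>presented_group S R\<^esub> (pres_rel S R `` {v})
    = pres_rel S R `` {u @ v}"
proof -
  have "(\<lambda>u v. pres_rel S R `` {u @ v}) respects2 pres_rel S R"
  proof (rule congruent2I')
    fix a a' b b'
    assume "(a, a') \<in> pres_rel S R" "(b, b') \<in> pres_rel S R"
    then have "pres_eq S R (a @ b) (a' @ b')"
      by (simp add: pres_rel_def pres_eq.append)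
    then show "pres_rel S R `` {a @ b} = pres_rel S R `` {a' @ b'}"
      using pres_eq_words pres_class_eq_iff by blast
  qed
  from UN_equiv_class2[OF equiv_pres_rel equiv_pres_rel this assms]
  show ?thesis by (simp add: presented_group_def)
qed

lemma word_inverse:
  assumes "u \<in> words S"
  shows "\<exists>v\<in>words S. pres_eq S R (v @ u) []"
  using assms
proof (induction u)
  case Nil
  then show ?case using pres_eq.refl[of "[]" S R] by (auto simp: words_def)
next
  case (Cons l u)
  obtain x b where l: "l = (x, b)" by force
  from Cons.prems have x: "x \<in> S" and u: "u \<in> words S" by (auto simp: words_def l)
  from Cons.IH[OF u] obtain v where v: "v \<in> words S" "pres_eq S R (v @ u) []" by blast
  have "pres_eq S R [(x, \<not> b), (x, b)] []"
    using pres_eq.cancel[OF x, of R "\<not> b"] by simp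
  from pres_eq.append[OF this pres_eq.refl[OF u]]
  have "pres_eq S R ((x, \<not> b) # (x, b) # u) u" by simp
  from pres_eq.append[OF pres_eq.refl[OF v(1)] this] v(2)
  have "pres_eq S R ((v @ [(x, \<not> b)]) @ l # u) []"
    by (auto simp: l intro: pres_eq.trans)
  moreover have "v @ [(x, \<not> b)] \<in> words S" using v(1) x by (auto simp: words_def)
  ultimately show ?case by blast
qed

lemma words_append: "\<lbrakk>u \<in> words S; v \<in> words S\<rbrakk> \<Longrightarrow> u @ v \<in> words S"
  by (simp add: words_def)

lemma words_Nil: "[] \<in> words S"
  by (simp add: words_def)

lemma group_presented_group: "group (presented_group S R)"
proof (rule groupI)
  fix A assume "A \<in> carrier (presented_group S R)"
  then obtain u where u: "u \<in> words S" "A = pres_rel S R `` {u}"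
    by (auto simp: presented_group_carrier)
  then obtain v where v: "v \<in> words S" "pres_eq S R (v @ u) []"
    using word_inverse by blast
  then have "(pres_rel S R `` {v}) \<otimes>\<^bsub>presented_group S R\<^esub> A = \<one>\<^bsub>presented_group S R\<^esub>"
    using u pres_class_eq_iff[OF words_append[OF v(1) u(1)] words_Nil]
    by (simp add: presented_group_mult presented_group_one)
  then show "\<exists>B\<in>carrier (presented_group S R).
      B \<otimes>\<^bsub>presented_group S R\<^esub> A = \<one>\<^bsub>presented_group S R\<^esub>"
    using v(1) by (auto simp: presented_group_carrier)
qed (auto simp: presented_group_carrier presented_group_one presented_group_mult
      words_append words_Nil)

definition env_relations :: "'a set \<Rightarrow> ('a \<Rightarrow> 'a \<Rightarrow> 'a) \<Rightarrow> ('a word \<times> 'a word) set" where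
  "env_relations Q star =
    {([(star x y, True)], [(y, False), (x, True), (y, True)]) | x y. x \<in> Q \<and> y \<in> Q}"

definition Env :: "'a set \<Rightarrow> ('a \<Rightarrow> 'a \<Rightarrow> 'a) \<Rightarrow> 'a word set monoid" where
  "Env Q star = presented_group Q (env_relations Q star)"

definition env_map :: "'a set \<Rightarrow> ('a \<Rightarrow> 'a \<Rightarrow> 'a) \<Rightarrow> 'a \<Rightarrow> 'a word set" where
  "env_map Q star x = pres_rel Q (env_relations Q star) `` {[(x, True)]}"

lemma group_Env: "group (Env Q star)"
  by (simp add: Env_def group_presented_group)

lemma env_map_quandle_hom:
  assumes "quandle Q star"
  shows "env_map Q star \<in> quandle_hom Q star (carrier (Env Q star)) (conj_op (Env Q star))"
proof -
  interpret quandle Q star by fact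
  let ?R = "env_relations Q star"
  let ?c = "\<lambda>u. pres_rel Q ?R `` {u}"
  interpret E: group "Env Q star" by (rule group_Env)
  have w: "[(x, b)] \<in> words Q" if "x \<in> Q" for x b
    using that by (simp add: words_def)
  have car: "?c u \<in> carrier (Env Q star)" if "u \<in> words Q" for u
    using that by (auto simp: Env_def presented_group_carrier)
  have mul: "?c u \<otimes>\<^bsub>Env Q star\<^esub> ?c v = ?c (u @ v)" if "u \<in> words Q" "v \<in> words Q" for u v
    using that by (simp add: Env_def presented_group_mult)
  have inv: "inv\<^bsub>Env Q star\<^esub> (env_map Q star y) = ?c [(y, False)]" if y: "y \<in> Q" for y
  proof (rule E.inv_equality)
    have "pres_eq Q ?R [(y, False), (y, True)] []"
      using pres_eq.cancel[OF y, of ?R False] by simp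
    then show "?c [(y, False)] \<otimes>\<^bsub>Env Q star\<^esub> env_map Q star y = \<one>\<^bsub>Env Q star\<^esub>"
      using pres_class_eq_iff pres_eq_words
      by (fastforce simp: env_map_def mul w y Env_def presented_group_mult presented_group_one)
  qed (use y in \<open>auto simp: env_map_def car w\<close>)
  have "env_map Q star (star x y) = conj_op (Env Q star) (env_map Q star x) (env_map Q star y)"
    if xy: "x \<in> Q" "y \<in> Q" for x y
  proof -
    have "conj_op (Env Q star) (env_map Q star x) (env_map Q star y)
        = ?c [(y, False), (x, True), (y, True)]"
      using xy by (simp add: conj_op_def inv) (simp add: env_map_def mul w words_def)
    moreover have "pres_eq Q ?R [(star x y, True)] [(y, False), (x, True), (y, True)]"
      using xy closed by (intro pres_eq.rel) (auto simp: env_relations_def words_def)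
    ultimately show ?thesis
      using pres_class_eq_iff pres_eq_words unfolding env_map_def by metis
  qed
  then show ?thesis by (auto simp: quandle_hom_def env_map_def car w)
qed

end

theory Submission
  imports Defs
begin

text \<open>
  The set \<open>\<eta>(Q)\<close> is closed under conjugation in \<open>Env(Q)\<close>, so the two given elements are
  \<open>\<eta>(x)\<^sup>\<plusminus>\<^sup>1\<close> and \<open>\<eta>(y)\<^sup>\<plusminus>\<^sup>1\<close> with \<open>x \<noteq> y\<close>, and \<open>\<eta>(x)\<close>, \<open>\<eta>(y)\<close> commute. Injectivity of \<open>\<eta>\<close> then
  gives \<open>x * y = x = x * x\<close>, whereas left multiplication by \<open>x\<close> is injective in a left-orderable
  quandle.
\<close>

lemma env_map_closed: "x \<in> Q \<Longrightarrow> env_map Q star x \<in> carrier (Env Q star)"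
  by (auto simp: env_map_def Env_def presented_group_carrier words_def)

lemma inv_env_map:
  assumes "x \<in> Q"
  shows "inv\<^bsub>Env Q star\<^esub> (env_map Q star x) = pres_rel Q (env_relations Q star) `` {[(x, False)]}"
proof -
  interpret E: group "Env Q star" by (rule group_Env)
  have w: "[(x, b)] \<in> words Q" "[(x, b), (x, c)] \<in> words Q" for b c
    using assms by (simp_all add: words_def)
  have "pres_eq Q (env_relations Q star) [(x, False), (x, True)] []"
    using pres_eq.cancel[OF assms, of _ False] by simp
  then have "pres_rel Q (env_relations Q star) `` {[(x, False)]} \<otimes>\<^bsub>Env Q star\<^esub> env_map Q star x
      = \<one>\<^bsub>Env Q star\<^esub>"
    by (simp add: env_map_def Env_def presented_group_mult presented_group_one w
        pres_class_eq_iff words_Nil)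
  then show ?thesis
    using w by (intro E.inv_equality)
      (auto simp: env_map_def Env_def presented_group_carrier)
qed

text \<open>Every element is the class of a word, so induction on the word adds one letter at a
  time. The letter is added on the left because conjugation by \<open>y g\<close> conjugates first
  by \<open>y\<close> and then by \<open>g\<close>, so the induction hypothesis for \<open>g\<close>
  applies after a single quandle step.\<close>

lemma Env_induct [consumes 1, case_names one mult inv_mult]:
  assumes "g \<in> carrier (Env Q star)"
    and "P \<one>\<^bsub>Env Q star\<^esub>"
    and mult: "\<And>y g. \<lbrakk>y \<in> Q; g \<in> carrier (Env Q star); P g\<rbrakk>
      \<Longrightarrow> P (env_map Q star y \<otimes>\<^bsub>Env Q star\<^esub> g)"
    and inv_mult: "\<And>y g. \<lbrakk>y \<in> Q; g \<in> carrier (Env Q star); P g\<rbrakk>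
      \<Longrightarrow> P (inv\<^bsub>Env Q star\<^esub> (env_map Q star y) \<otimes>\<^bsub>Env Q star\<^esub> g)"
  shows "P g"
proof -
  let ?c = "\<lambda>u. pres_rel Q (env_relations Q star) `` {u}"
  obtain w where w: "w \<in> words Q" "g = ?c w"
    using assms(1) by (auto simp: Env_def presented_group_carrier)
  have "P (?c w)"
    using w(1)
  proof (induction w)
    case Nil
    then show ?case using assms(2) by (simp add: Env_def presented_group_one)
  next
    case (Cons l w)
    obtain y b where l: "l = (y, b)" by force
    have y: "y \<in> Q" and w: "w \<in> words Q" using Cons.prems by (auto simp: words_def l)
    have cw: "?c w \<in> carrier (Env Q star)"
      using w by (auto simp: Env_def presented_group_carrier)
    have "?c (l # w) = ?c [(y, b)] \<otimes>\<^bsub>Env Q star\<^esub> ?c w"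
      using y w by (simp add: Env_def presented_group_mult words_def l)
    moreover have "P (?c [(y, b)] \<otimes>\<^bsub>Env Q star\<^esub> ?c w)"
    proof (cases b)
      case True
      then show ?thesis using mult[OF y cw Cons.IH[OF w]] by (simp add: env_map_def)
    next
      case False
      then show ?thesis using inv_mult[OF y cw Cons.IH[OF w]] by (simp add: inv_env_map y)
    qed
    ultimately show ?case by simp
  qed
  then show ?thesis using w(2) by simp
qed

text \<open>Conjugation by \<eta>(y) acts on \<eta>(Q) as right multiplication by \<open>y\<close>,
  and conjugation by its inverse as right division, so each letter of \<open>g\<close> keeps the
  image inside \<eta>(Q). The element \<open>x\<close> changes with every letter, hence it is left
  arbitrary in the induction.\<close>

lemma conj_env_map_in_range:
  assumes "quandle Q star" "g \<in> carrier (Env Q star)" "x \<in> Q"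
  shows "conj_op (Env Q star) (env_map Q star x) g \<in> env_map Q star ` Q"
  using assms(2,3)
proof (induction g arbitrary: x rule: Env_induct)
  case one
  interpret E: group "Env Q star" by (rule group_Env)
  show ?case using one by (auto simp: conj_op_def env_map_closed)
next
  case (mult y g)
  interpret quandle Q star by fact
  interpret E: group "Env Q star" by (rule group_Env)
  have "env_map Q star (star x y) = conj_op (Env Q star) (env_map Q star x) (env_map Q star y)"
    using env_map_quandle_hom[OF assms(1)] mult by (auto simp: quandle_hom_def)
  then have "conj_op (Env Q star) (env_map Q star x) (env_map Q star y \<otimes>\<^bsub>Env Q star\<^esub> g)
      = conj_op (Env Q star) (env_map Q star (star x y)) g"
    using mult by (simp add: conj_op_def env_map_closed E.inv_mult_group E.m_assoc)
  then show ?case using mult closed by simp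
next
  case (inv_mult y g)
  interpret quandle Q star by fact
  interpret E: group "Env Q star" by (rule group_Env)
  \<comment> \<open>This \<open>z\<close> is the right quotient of \<open>x\<close> by
    \<open>y\<close>: conjugating \<eta>(x) by the inverse of \<eta>(y) gives \<eta>(z).\<close>
  obtain z where z: "z \<in> Q" "x = star z y" using right_div inv_mult by blast
  have [simp]: "env_map Q star y \<in> carrier (Env Q star)" "env_map Q star z \<in> carrier (Env Q star)"
    using z inv_mult by (auto simp: env_map_closed)
  have cancel: "env_map Q star y \<otimes>\<^bsub>Env Q star\<^esub> (inv\<^bsub>Env Q star\<^esub> env_map Q star y \<otimes>\<^bsub>Env Q star\<^esub> h) = h"
    if "h \<in> carrier (Env Q star)" for h
    using that by (simp add: E.m_assoc[symmetric])
  have "env_map Q star x = conj_op (Env Q star) (env_map Q star z) (env_map Q star y)"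
    using env_map_quandle_hom[OF assms(1)] inv_mult z by (auto simp: quandle_hom_def)
  then have "conj_op (Env Q star) (env_map Q star x)
        (inv\<^bsub>Env Q star\<^esub> (env_map Q star y) \<otimes>\<^bsub>Env Q star\<^esub> g)
      = conj_op (Env Q star) (env_map Q star z) g"
    using inv_mult by (simp add: conj_op_def E.inv_mult_group E.m_assoc cancel)
  then show ?case using inv_mult z by simp
qed

text \<open>Conjugation commutes with inversion, so the case of an inverted generator reduces to
  that of \<eta>(x) itself. The resulting \<open>q\<close> is only claimed to lie in
  \<open>Q\<close>, since conjugation may lead out of \<eta>(X).\<close>

lemma conjugate_of_generator:
  assumes "quandle Q star" "X \<subseteq> Q"
    and "h \<in> env_map Q star ` X \<union> (\<lambda>g. inv\<^bsub>Env Q star\<^esub> g) ` (env_map Q star ` X)"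
    and "conjugate_in (Env Q star) c h"
  obtains q where "q \<in> Q" "c = env_map Q star q \<or> c = inv\<^bsub>Env Q star\<^esub> (env_map Q star q)"
proof -
  interpret E: group "Env Q star" by (rule group_Env)
  obtain g where g: "g \<in> carrier (Env Q star)" "c = conj_op (Env Q star) h g"
    using assms(4) by (auto simp: conjugate_in_def conj_op_def)
  obtain x where x: "x \<in> Q" "h = env_map Q star x \<or> h = inv\<^bsub>Env Q star\<^esub> (env_map Q star x)"
    using assms(2,3) by auto
  obtain q where q: "q \<in> Q" "conj_op (Env Q star) (env_map Q star x) g = env_map Q star q"
    using conj_env_map_in_range[OF assms(1) g(1) x(1)] by auto
  have "conj_op (Env Q star) (inv\<^bsub>Env Q star\<^esub> (env_map Q star x)) g
      = inv\<^bsub>Env Q star\<^esub> (conj_op (Env Q star) (env_map Q star x) g)"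
    using g x by (simp add: conj_op_def env_map_closed E.inv_mult_group E.m_assoc)
  then show thesis using that g(2) x(2) q by auto
qed

text \<open>Multiply \<open>a \<otimes> b = b \<otimes> a\<close> by \<open>inv a\<close> on both
  sides. This removes the unknown exponents when commutation passes from the given pair to \<eta>(x)
  and \<eta>(y).\<close>

lemma (in group) commute_inv:
  assumes "a \<in> carrier G" "b \<in> carrier G" "a \<otimes> b = b \<otimes> a"
  shows "inv a \<otimes> b = b \<otimes> inv a"
  using assms by (metis inv_closed inv_solve_left inv_solve_right m_assoc m_closed)

theorem proposition5p3:
  fixes Q X :: "'a set" and star :: "'a \<Rightarrow> 'a \<Rightarrow> 'a"
  assumes "quandle Q star"
    and "quandle_generated_by Q star X"
    and "inj_on (env_map Q star) Q"
    and "\<exists>a\<in>carrier (Env Q star). \<exists>b\<in>carrier (Env Q star).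
      a \<noteq> b \<and> a \<otimes>\<^bsub>Env Q star\<^esub> b = b \<otimes>\<^bsub>Env Q star\<^esub> a \<and> a \<noteq> inv\<^bsub>Env Q star\<^esub> b \<and>
      (\<forall>c\<in>{a, b}. \<exists>h\<in>env_map Q star ` X \<union> (\<lambda>g. inv\<^bsub>Env Q star\<^esub> g) ` (env_map Q star ` X).
        conjugate_in (Env Q star) c h)"
  shows "\<not> left_orderable Q star"
proof
  assume "left_orderable Q star"
  then obtain r where r: "strict_linear_order_on Q r"
    and mono: "\<And>x y z. \<lbrakk>x \<in> Q; y \<in> Q; z \<in> Q; (x, y) \<in> r\<rbrakk> \<Longrightarrow> (star z x, star z y) \<in> r"
    unfolding left_orderable_def by metis
  interpret quandle Q star by fact
  interpret E: group "Env Q star" by (rule group_Env)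
  let ?e = "env_map Q star"
  have X: "X \<subseteq> Q" using assms(2) by (simp add: quandle_generated_by_def)
  from assms(4) obtain a b h k where ab: "a \<in> carrier (Env Q star)" "b \<in> carrier (Env Q star)"
    "a \<noteq> b" "a \<otimes>\<^bsub>Env Q star\<^esub> b = b \<otimes>\<^bsub>Env Q star\<^esub> a" "a \<noteq> inv\<^bsub>Env Q star\<^esub> b"
    and h: "h \<in> ?e ` X \<union> (\<lambda>g. inv\<^bsub>Env Q star\<^esub> g) ` (?e ` X)" "conjugate_in (Env Q star) a h"
    and k: "k \<in> ?e ` X \<union> (\<lambda>g. inv\<^bsub>Env Q star\<^esub> g) ` (?e ` X)" "conjugate_in (Env Q star) b k"
    by (metis insertI1 insertI2)
  obtain x where x: "x \<in> Q" "a = ?e x \<or> a = inv\<^bsub>Env Q star\<^esub> (?e x)"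
    using conjugate_of_generator[OF assms(1) X h] .
  obtain y where y: "y \<in> Q" "b = ?e y \<or> b = inv\<^bsub>Env Q star\<^esub> (?e y)"
    using conjugate_of_generator[OF assms(1) X k] .
  have cl: "?e x \<in> carrier (Env Q star)" "?e y \<in> carrier (Env Q star)"
    using x y by (auto simp: env_map_closed)
  \<comment> \<open>If \<open>x = y\<close>, then \<open>a\<close> and \<open>b\<close> both lie in
    the set of \<eta>(x) and its inverse, so they are equal or mutually inverse.\<close>
  have "x \<noteq> y" using x y ab(3,5) cl by auto
  have ex: "?e x = a \<or> ?e x = inv\<^bsub>Env Q star\<^esub> a" and ey: "?e y = b \<or> ?e y = inv\<^bsub>Env Q star\<^esub> b"
    using x y cl by auto
  \<comment> \<open>Commutation is transferred one factor at a time: first \<open>a\<close> is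
    replaced by \<eta>(x), then \<open>b\<close> by \<eta>(y).\<close>
  have "?e x \<otimes>\<^bsub>Env Q star\<^esub> b = b \<otimes>\<^bsub>Env Q star\<^esub> ?e x"
    using ex ab E.commute_inv by metis
  then have comm: "?e x \<otimes>\<^bsub>Env Q star\<^esub> ?e y = ?e y \<otimes>\<^bsub>Env Q star\<^esub> ?e x"
    using ey ab(2) cl E.commute_inv by metis
  have "?e (star x y) = conj_op (Env Q star) (?e x) (?e y)"
    using env_map_quandle_hom[OF assms(1)] x y by (auto simp: quandle_hom_def)
  also have "\<dots> = ?e x"
    using cl comm by (simp add: conj_op_def E.m_assoc E.inv_solve_left')
  finally have "star x y = star x x"
    using assms(3) x y closed idem by (auto dest: inj_onD)
  moreover have "(x, y) \<in> r \<or> (y, x) \<in> r"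
    using r x y \<open>x \<noteq> y\<close> by (auto simp: strict_linear_order_on_def total_on_def)
  \<comment> \<open>Whichever of \<open>x\<close> and \<open>y\<close> is smaller, left
    multiplication by \<open>x\<close> sends the pair to \<open>star x x\<close> and
    \<open>star x y\<close> in some order, and these two coincide.\<close>
  ultimately have "(star x x, star x x) \<in> r"
    using mono x y by metis
  then show False
    using r by (auto simp: strict_linear_order_on_def irrefl_def)
qed

end
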